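(* Consider an exponential family $p(x|\theta)=e^{\theta\cdot h(x)+k(x)-\psi(\theta)}$ with two-dimensional parameter $\theta=(\theta_1,\theta_2)$ ranging over an open set $\Theta\subseteq\mathbb{R}^2$, with $\psi$ smooth and with (non-degenerate) metric tensor $g_{ij}(\theta)=\partial_i\partial_j\psi(\theta)$, and let $S(\theta)$ be its curvature. 1. If some metric tensor element is identically zero (i.e. $g_{ij}(\theta)=0$ for all $\theta$, for some $i,j$), then $S(\theta)=0$ and the geometry is flat. Hence all metric tensors of any one of the forms $$\begin{pmatrix} 0 & g_{12} \\ g_{12} & g_{22} \end{pmatrix},\quad \begin{pmatrix} g_{11} & g_{12} \\ g_{12} & 0 \end{pmatrix},\quad \begin{pmatrix} g_{11} & 0 \\ 0 & g_{22} \end{pmatrix}$$ induce a flat geometry. 2. If two distinct ones among the components $g_{11},g_{12},g_{22}$ are linearly dependent (i.e. there is $\lambda\in\mathbb{R}$ with $g_{ij}(\theta)=\lambda g_{kl}(\theta)$ for all $\theta$), then $S(\theta)=0$ and the geometry is flat. Hence all metric tensors of any one of the forms $$\begin{pmatrix} g_{11} & \lambda g_{22} \\ \lambda g_{22} & g_{22} \end{pmatrix},\quad \begin{pmatrix} g_{11} & \lambda g_{11} \\ \lambda g_{11} & g_{22} \end{pmatrix},\quad \begin{pmatrix} \lambda g_{12} & g_{12} \\ g_{12} & g_{22} \end{pmatrix},\quad \begin{pmatrix} g_{11} & g_{12} \\ g_{12} & \lambda g_{12} \end{pmatrix},\quad \begin{pmatrix} \lambda g_{22} & g_{12} \\ g_{12}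 & g_{22} \end{pmatrix}$$ for some $\lambda\in\mathbb{R}$ induce a flat geometry. 3. If all the metric tensor elements depend on just one of the two parameters, then $S(\theta)=0$ and the geometry is flat. Hence all metric tensors of any one of the forms $$\begin{pmatrix} g_{11}(\theta_1) & g_{12}(\theta_1) \\ g_{12}(\theta_1) & g_{22}(\theta_1) \end{pmatrix},\quad \begin{pmatrix} g_{11}(\theta_2) & g_{12}(\theta_2) \\ g_{12}(\theta_2) & g_{22}(\theta_2) \end{pmatrix}$$ induce a flat geometry.
   Context: Exponential family: given functions $h(x)=(h_1(x),h_2(x))$, $k(x)$ and a scalar function $\psi(\theta)$ (the regularization function, which is convex and normalizes the densities), the family consists of the probability densities $p(x|\theta)=e^{\theta\cdot h(x)+k(x)-\psi(\theta)}$ on $x\in\mathbb{R}^m$. Its Fisher metric tensor $g_{ij}(\theta)=\mathbb{E}[-\partial_i\partial_j\log p(x|\theta)]$ equals the Hessian $\partial_i\partial_j\psi(\theta)$, where $\partial_i=\frac{\partial}{\partial\theta_i}$; in particular $g_{12}=g_{21}$. Curvature of a metric tensor $g_{ij}$ in coordinates $x^1,\dots,x^d$ (here $d=2$ and $x^i=\theta_i$; Einstein summation): $\Gamma^i_{jk}=\frac12 g^{il}\left(\frac{\partial g_{lj}}{\partial x^k}+\frac{\partial g_{lk}}{\partial x^j}-\frac{\partial g_{jk}}{\partial x^l}\right)$, $\Gamma^i_{jk,\lambda}=\frac{\partial\Gamma^i_{jk}}{\partial x^\lambda}$, $$S_R=g^{\mu\nu}\left(\Gamma^\lambda_{\mu\nu,\lambda}-\Gamma^\lambda_{\mu\lambda,\nu}+\Gamma^\sigma_{\mu\nu}\Gamma^\lambda_{\lambda\sigma}-\Gamma^\sigma_{\mu\lambda}\Gamma^\lambda_{\nu\sigma}\right),$$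 and the curvature is $S=\frac1d S_R=\frac12 S_R$ (for $d=2$ this is the Gaussian curvature). The geometry is (locally) flat when $S(\theta)=0$ for all $\theta$. *)

theory Defs
  imports "HOL-Probability.Probability"
begin

subsection \<open>Partial derivatives and smoothness\<close>

definition partial_deriv :: "'n \<Rightarrow> (real^'n::finite \<Rightarrow> real) \<Rightarrow> real^'n \<Rightarrow> real" where
  "partial_deriv i f x = deriv (\<lambda>t. f (x + t *\<^sub>R axis i 1)) 0"

text \<open>\<open>C\<^sup>\<infinity>\<close>: every iterated partial derivative (including \<open>f\<close> itself, for the
  empty list of indices) is Frechet differentiable, hence continuous, at each point of \<open>S\<close>.
  Meant for open \<open>S\<close>; the values of \<open>f\<close> outside \<open>S\<close> are then irrelevant.\<close>

definition smooth_fun_on :: "(real^'n::finite) set \<Rightarrow> (real^'n \<Rightarrow> real) \<Rightarrow> bool" where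
  "smooth_fun_on S f \<longleftrightarrow> (\<forall>is. \<forall>x\<in>S. foldr partial_deriv is f differentiable (at x))"

definition hessian :: "(real^'n::finite \<Rightarrow> real) \<Rightarrow> real^'n \<Rightarrow> real^'n^'n" where
  "hessian f x = (\<chi> i j. partial_deriv i (partial_deriv j f) x)"


subsection \<open>Curvature of a metric tensor\<close>

text \<open>\<open>christoffel g i j k\<close> has the upper index \<open>i\<close> and the lower indices \<open>j\<close>, \<open>k\<close>.\<close>

definition christoffel ::
    "(real^'n::finite \<Rightarrow> real^'n^'n) \<Rightarrow> 'n \<Rightarrow> 'n \<Rightarrow> 'n \<Rightarrow> real^'n \<Rightarrow> real" where
  "christoffel g i j k x =
     1/2 * (\<Sum>l\<in>UNIV. matrix_inv (g x) $ i $ l *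
       (partial_deriv k (\<lambda>y. g y $ l $ j) x
        + partial_deriv j (\<lambda>y. g y $ l $ k) x
        - partial_deriv l (\<lambda>y. g y $ j $ k) x))"

definition scalar_curvature :: "(real^'n::finite \<Rightarrow> real^'n^'n) \<Rightarrow> real^'n \<Rightarrow> real" where
  "scalar_curvature g x =
     (\<Sum>\<mu>\<in>UNIV. \<Sum>\<nu>\<in>UNIV. matrix_inv (g x) $ \<mu> $ \<nu> *
       ((\<Sum>\<kappa>\<in>UNIV. partial_deriv \<kappa> (christoffel g \<kappa> \<mu> \<nu>) x)
        - (\<Sum>\<kappa>\<in>UNIV. partial_deriv \<nu> (christoffel g \<kappa> \<mu> \<kappa>) x)
        + (\<Sum>\<sigma>\<in>UNIV. \<Sum>\<kappa>\<in>UNIV. christoffel g \<sigma> \<mu> \<nu> x * christoffel g \<kappa> \<kappa> \<sigma> x)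
        - (\<Sum>\<sigma>\<in>UNIV. \<Sum>\<kappa>\<in>UNIV. christoffel g \<sigma> \<mu> \<kappa> x * christoffel g \<kappa> \<nu> \<sigma> x)))"

definition curvature :: "(real^'n::finite \<Rightarrow> real^'n^'n) \<Rightarrow> real^'n \<Rightarrow> real" where
  "curvature g x = scalar_curvature g x / real CARD('n)"

definition flat_on :: "(real^'n::finite) set \<Rightarrow> (real^'n \<Rightarrow> real^'n^'n) \<Rightarrow> bool" where
  "flat_on S g \<longleftrightarrow> (\<forall>x\<in>S. curvature g x = 0)"


subsection \<open>Exponential families with two parameters\<close>

definition expfam_density ::
    "(real^'m::finite \<Rightarrow> real^2) \<Rightarrow> (real^'m \<Rightarrow> real) \<Rightarrow> (real^2 \<Rightarrow> real) \<Rightarrow> real^2 \<Rightarrow> real^'m \<Rightarrow> real"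
  where "expfam_density h k \<psi> \<theta> x = exp (\<theta> \<bullet> h x + k x - \<psi> \<theta>)"

definition expfam_measure ::
    "(real^'m::finite \<Rightarrow> real^2) \<Rightarrow> (real^'m \<Rightarrow> real) \<Rightarrow> (real^2 \<Rightarrow> real) \<Rightarrow> real^2 \<Rightarrow> (real^'m) measure"
  where "expfam_measure h k \<psi> \<theta> = density lborel (\<lambda>x. ennreal (expfam_density h k \<psi> \<theta> x))"

text \<open>The parameter set need not be convex, so convexity of the regularization function is
  required on its convex subsets.\<close>

definition exponential_family ::
    "(real^2) set \<Rightarrow> (real^'m::finite \<Rightarrow> real^2) \<Rightarrow> (real^'m \<Rightarrow> real) \<Rightarrow> (real^2 \<Rightarrow> real) \<Rightarrow> bool" where
  "exponential_family \<Theta> h k \<psi> \<longleftrightarrow>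
     h \<in> borel_measurable borel \<and> k \<in> borel_measurable borel \<and>
     (\<forall>\<theta>\<in>\<Theta>. prob_space (expfam_measure h k \<psi> \<theta>)) \<and>
     (\<forall>C. convex C \<and> C \<subseteq> \<Theta> \<longrightarrow> convex_on C \<psi>)"

definition fisher_metric ::
    "(real^'m::finite \<Rightarrow> real^2) \<Rightarrow> (real^'m \<Rightarrow> real) \<Rightarrow> (real^2 \<Rightarrow> real) \<Rightarrow> real^2 \<Rightarrow> real^2^2" where
  "fisher_metric h k \<psi> \<theta> =
     (\<chi> i j. prob_space.expectation (expfam_measure h k \<psi> \<theta>)
        (\<lambda>x. - partial_deriv i (partial_deriv j (\<lambda>\<eta>. ln (expfam_density h k \<psi> \<eta> x))) \<theta>))"

definition sym_mat2 :: "real \<Rightarrow> real \<Rightarrow> real \<Rightarrow> real^2^2" where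
  "sym_mat2 a b c = vector [vector [a, b], vector [b, c]]"


subsection \<open>The Fisher metric is the Hessian of the regularization function\<close>

lemma has_partial_deriv:
  assumes "f differentiable (at x)"
  shows "((\<lambda>t. f (x + t *\<^sub>R axis i 1)) has_real_derivative partial_deriv i f x) (at 0)"
proof -
  have "f differentiable (at (x + 0 *\<^sub>R axis i 1))" using assms by simp
  moreover have "(\<lambda>t::real. x + t *\<^sub>R axis i 1) differentiable (at 0)" by simp
  ultimately have "(\<lambda>t. f (x + t *\<^sub>R axis i 1)) differentiable (at (0::real))"
    using differentiable_compose[of f "\<lambda>t. x + t *\<^sub>R axis i 1" 0 UNIV] by simp
  then show ?thesis
    unfolding partial_deriv_def
    using DERIV_deriv_iff_real_differentiable by blast
qed

lemma partial_deriv_cong_open: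
  assumes "open S" "x \<in> S" "\<And>y. y \<in> S \<Longrightarrow> f y = g y"
  shows "partial_deriv i f x = partial_deriv i g x"
proof -
  have "((\<lambda>t::real. x + t *\<^sub>R axis i 1) \<longlongrightarrow> x + 0 *\<^sub>R axis i 1) (nhds 0)"
    by (intro tendsto_intros filterlim_ident)
  then have "eventually (\<lambda>t::real. x + t *\<^sub>R axis i 1 \<in> S) (nhds 0)"
    using assms(1,2) by (simp add: topological_tendstoD)
  then have "eventually (\<lambda>t::real. f (x + t *\<^sub>R axis i 1) = g (x + t *\<^sub>R axis i 1)) (nhds 0)"
    by eventually_elim (use assms(3) in auto)
  then show ?thesis unfolding partial_deriv_def by (rule deriv_cong_ev) simp
qed

lemma fisher_metric_eq_hessian:
  assumes "open \<Theta>" "exponential_family \<Theta> h k \<psi>" "smooth_fun_on \<Theta> \<psi>" "\<theta> \<in> \<Theta>"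
  shows "fisher_metric h k \<psi> \<theta> = hessian \<psi> \<theta>"
proof -
  interpret prob_space "expfam_measure h k \<psi> \<theta>"
    using assms(2,4) by (auto simp: exponential_family_def)
  have d0: "\<psi> differentiable (at \<eta>)" if "\<eta> \<in> \<Theta>" for \<eta>
    using assms(3) that by (auto simp: smooth_fun_on_def dest!: spec[of _ "[]"])
  have d1: "partial_deriv j \<psi> differentiable (at \<theta>)" for j
    using assms(3,4) by (auto simp: smooth_fun_on_def dest!: spec[of _ "[j]"])
  have "partial_deriv j (\<lambda>\<eta>. ln (expfam_density h k \<psi> \<eta> x)) \<eta> = h x $ j - partial_deriv j \<psi> \<eta>"
    if "\<eta> \<in> \<Theta>" for j x \<eta>
  proof -
    have "((\<lambda>t. (\<eta> + t *\<^sub>R axis j 1) \<bullet> h x + k x - \<psi> (\<eta> + t *\<^sub>R axis j 1))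
        has_real_derivative h x $ j - partial_deriv j \<psi> \<eta>) (at 0)"
      by (auto intro!: derivative_eq_intros has_partial_deriv d0 that
          simp: inner_add_left inner_axis' )
    then show ?thesis
      unfolding partial_deriv_def[of j "\<lambda>\<eta>. ln (expfam_density h k \<psi> \<eta> x)"]
      by (simp add: expfam_density_def DERIV_imp_deriv)
  qed
  then have "partial_deriv i (partial_deriv j (\<lambda>\<eta>. ln (expfam_density h k \<psi> \<eta> x))) \<theta>
      = partial_deriv i (\<lambda>\<eta>. h x $ j - partial_deriv j \<psi> \<eta>) \<theta>" for i j x
    by (intro partial_deriv_cong_open[OF assms(1,4)])
  moreover have "partial_deriv i (\<lambda>\<eta>. h x $ j - partial_deriv j \<psi> \<eta>) \<theta>
      = - partial_deriv i (partial_deriv j \<psi>) \<theta>" for i j x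
  proof -
    have "((\<lambda>t. h x $ j - partial_deriv j \<psi> (\<theta> + t *\<^sub>R axis i 1))
        has_real_derivative - partial_deriv i (partial_deriv j \<psi>) \<theta>) (at 0)"
      by (auto intro!: derivative_eq_intros has_partial_deriv d1)
    then show ?thesis
      unfolding partial_deriv_def[of i "\<lambda>\<eta>. h x $ j - partial_deriv j \<psi> \<eta>"]
      by (rule DERIV_imp_deriv)
  qed
  ultimately show ?thesis
    by (simp add: fisher_metric_def hessian_def vec_eq_iff prob_space)
qed

end

(*
For a Hessian metric the Christoffel symbols are half the third derivatives of the potential,
contracted with the inverse metric, so the fourth derivatives cancel in the curvature tensor.
In two dimensions, with a, b, c = g11, g12, g22, what remains is the Gaussian curvature
  S = - det [[a, b, c], [d1 a, d1 b, d1 c], [d2 a, d2 b, d2 c]] / (4 (det g)^2).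
A constant-coefficient linear relation between a, b, c makes the columns of the 3x3 matrix
dependent, and dependence on a single parameter makes one of its last two rows vanish.
*)

theory Submission
  imports Defs
begin

section \<open>Smooth functions and the symmetry of mixed partial derivatives\<close>

lemma smooth_fun_onD:
  assumes "smooth_fun_on S f" "x \<in> S"
  shows "f differentiable (at x)"
  using assms by (auto simp: smooth_fun_on_def dest!: spec[of _ "[]"])

lemma smooth_fun_on_partial_deriv:
  assumes "smooth_fun_on S f"
  shows "smooth_fun_on S (partial_deriv i f)"
  unfolding smooth_fun_on_def
proof
  fix "is"
  show "\<forall>x\<in>S. foldr partial_deriv is (partial_deriv i f) differentiable (at x)"
    \<comment> \<open>\<open>foldr\<close> applies the last list entry first, so the innermost
      derivative is appended at the end.\<close>
    using assms[unfolded smooth_fun_on_def, rule_format, of _ "is @ [i]"] by simp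
qed

text \<open>\<open>partial_deriv\<close> is defined by a derivative at parameter 0. Shifting the
  parameter gives derivatives along a whole segment, as the mean value theorem requires.\<close>

lemma has_partial_deriv_line:
  assumes "f differentiable (at (y + s *\<^sub>R axis i 1))"
  shows "((\<lambda>t. f (y + t *\<^sub>R axis i 1)) has_real_derivative
           partial_deriv i f (y + s *\<^sub>R axis i 1)) (at s)"
proof -
  have "((\<lambda>t. f (y + (t + s) *\<^sub>R axis i 1)) has_real_derivative
           partial_deriv i f (y + s *\<^sub>R axis i 1)) (at 0)"
    using has_partial_deriv[OF assms, of i] by (simp add: algebra_simps)
  then show ?thesis
    using DERIV_shift[of "\<lambda>t. f (y + t *\<^sub>R axis i 1)" _ 0 s] by simp
qed

text \<open>The mean value theorem is applied twice, first along \<open>i\<close> and then along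
  \<open>j\<close>. The bound \<open>2 * t < e\<close> keeps all points reached by steps of length
  at most \<open>t\<close> in both directions inside the ball, by the triangle inequality; this
  includes the case \<open>i = j\<close>.\<close>

lemma second_difference_mvt:
  fixes f :: "real^'n::finite \<Rightarrow> real"
  assumes f: "smooth_fun_on (ball x e) f" and t: "0 < t" "2 * t < e"
  shows "\<exists>s r. 0 < s \<and> s < t \<and> 0 < r \<and> r < t \<and>
    f (x + t *\<^sub>R axis i 1 + t *\<^sub>R axis j 1) - f (x + t *\<^sub>R axis i 1) - f (x + t *\<^sub>R axis j 1) + f x
      = t\<^sup>2 * partial_deriv j (partial_deriv i f) (x + s *\<^sub>R axis i 1 + r *\<^sub>R axis j 1)"
proof -
  have ball: "x + s *\<^sub>R axis i 1 + r *\<^sub>R axis j 1 \<in> ball x e"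
    if "0 \<le> s" "s \<le> t" "0 \<le> r" "r \<le> t" for s r
  proof -
    have "norm (s *\<^sub>R axis i 1 + r *\<^sub>R axis j 1 :: real^'n) \<le> s + r"
      using norm_triangle_ineq[of "s *\<^sub>R axis i 1" "r *\<^sub>R axis j 1 :: real^'n"] that by simp
    then have "norm (s *\<^sub>R axis i 1 + r *\<^sub>R axis j 1 :: real^'n) < e" using that t by linarith
    then show ?thesis by (metis add.assoc add_diff_cancel_left' dist_norm dist_commute mem_ball)
  qed
  have d: "g differentiable (at (x + s *\<^sub>R axis i 1 + r *\<^sub>R axis j 1))"
    if "smooth_fun_on (ball x e) g" "0 \<le> s" "s \<le> t" "0 \<le> r" "r \<le> t" for g s r
    by (rule smooth_fun_onD[OF that(1) ball]) (use that in auto)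
  \<comment> \<open>The increment of \<open>?\<phi>\<close> over the interval from 0 to
    \<open>t\<close> is the second difference. Its derivative is an increment of
    \<open>partial_deriv i f\<close> along \<open>j\<close>, to which the second application
    refers.\<close>
  let ?\<phi> = "\<lambda>s. f (x + t *\<^sub>R axis j 1 + s *\<^sub>R axis i 1) - f (x + s *\<^sub>R axis i 1)"
  let ?D = "\<lambda>s r. partial_deriv i f (x + s *\<^sub>R axis i 1 + r *\<^sub>R axis j 1)"
  have "(?\<phi> has_real_derivative ?D s t - ?D s 0) (at s)" if "0 \<le> s" "s \<le> t" for s
  proof (rule DERIV_diff)
    show "((\<lambda>s. f (x + t *\<^sub>R axis j 1 + s *\<^sub>R axis i 1)) has_real_derivative ?D s t) (at s)"
      using has_partial_deriv_line[of f "x + t *\<^sub>R axis j 1" s i] d[OF f, of s t] that t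
      by (simp add: ac_simps)
    show "((\<lambda>s. f (x + s *\<^sub>R axis i 1)) has_real_derivative ?D s 0) (at s)"
      using has_partial_deriv_line[of f x s i] d[OF f, of s 0] that t by simp
  qed
  from MVT2[OF t(1) this] obtain s where s: "0 < s" "s < t"
    "?\<phi> t - ?\<phi> 0 = t * (?D s t - ?D s 0)" by auto
  have "((\<lambda>r. ?D s r) has_real_derivative
      partial_deriv j (partial_deriv i f) (x + s *\<^sub>R axis i 1 + r *\<^sub>R axis j 1)) (at r)"
    if "0 \<le> r" "r \<le> t" for r
    by (intro has_partial_deriv_line d smooth_fun_on_partial_deriv f) (use that s in auto)
  from MVT2[OF t(1) this] obtain r where r: "0 < r" "r < t" "?D s t - ?D s 0
      = t * partial_deriv j (partial_deriv i f) (x + s *\<^sub>R axis i 1 + r *\<^sub>R axis j 1)" by auto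
  have "?\<phi> t - ?\<phi> 0 = t\<^sup>2 * partial_deriv j (partial_deriv i f) (x + s *\<^sub>R axis i 1 + r *\<^sub>R axis j 1)"
    using s(3) r(3) by (simp add: power2_eq_square)
  then show ?thesis
    using s(1,2) r(1,2) by (force simp: ac_simps)
qed

text \<open>The second difference above is symmetric in \<open>i\<close> and \<open>j\<close>.\<close>

lemma partial_deriv_commute:
  fixes f :: "real^'n::finite \<Rightarrow> real"
  assumes "open S" "smooth_fun_on S f" "x \<in> S"
  shows "partial_deriv i (partial_deriv j f) x = partial_deriv j (partial_deriv i f) x"
proof -
  obtain e where e: "e > 0" "ball x e \<subseteq> S"
    using assms(1,3) open_contains_ball by blast
  have f: "smooth_fun_on (ball x e) f"
    using assms(2) e(2) unfolding smooth_fun_on_def by blast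
  define u where "u = partial_deriv i (partial_deriv j f)"
  define v where "v = partial_deriv j (partial_deriv i f)"
  \<comment> \<open>A null sequence; the factor 3 ensures \<open>2 * t n < e\<close> already for
    \<open>n = 0\<close>.\<close>
  define t where "t n = e / (3 * Suc n)" for n
  have t: "0 < t n" "2 * t n < e" for n
    using e(1) by (auto simp: t_def field_simps)
       (smt (verit) e(1) mult_nonneg_nonneg of_nat_0_le_iff)
  have "\<exists>s r s' r'. (\<bar>s\<bar> \<le> t n \<and> \<bar>r\<bar> \<le> t n \<and> \<bar>s'\<bar> \<le> t n \<and> \<bar>r'\<bar> \<le> t n) \<and>
      v (x + s *\<^sub>R axis i 1 + r *\<^sub>R axis j 1) = u (x + s' *\<^sub>R axis i 1 + r' *\<^sub>R axis j 1)" for n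
  proof -
    \<comment> \<open>Both instances expand the same second difference. In the second one the roles
      of the directions are exchanged, so \<open>s'\<close> runs along \<open>j\<close> and
      \<open>r'\<close> along \<open>i\<close>; hence the swapped witnesses below.\<close>
    from second_difference_mvt[OF f t, of n i j] second_difference_mvt[OF f t, of n j i]
    obtain s r s' r' where
      1: "0 < s" "s < t n" "0 < r" "r < t n" "0 < s'" "s' < t n" "0 < r'" "r' < t n" and
      "(t n)\<^sup>2 * v (x + s *\<^sub>R axis i 1 + r *\<^sub>R axis j 1)
        = (t n)\<^sup>2 * u (x + s' *\<^sub>R axis j 1 + r' *\<^sub>R axis i 1)"
      unfolding u_def v_def by (force simp: algebra_simps)
    then have "v (x + s *\<^sub>R axis i 1 + r *\<^sub>R axis j 1) = u (x + r' *\<^sub>R axis i 1 + s' *\<^sub>R axis j 1)"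
      using t[of n] by (simp add: ac_simps)
    then show ?thesis using 1
      by (intro exI[of _ s] exI[of _ r] exI[of _ r'] exI[of _ s']) simp
  qed
  then obtain s r s' r' where
    b: "\<And>n. \<bar>s n\<bar> \<le> t n" "\<And>n. \<bar>r n\<bar> \<le> t n" "\<And>n. \<bar>s' n\<bar> \<le> t n" "\<And>n. \<bar>r' n\<bar> \<le> t n" and
    eq: "\<And>n. v (x + s n *\<^sub>R axis i 1 + r n *\<^sub>R axis j 1) = u (x + s' n *\<^sub>R axis i 1 + r' n *\<^sub>R axis j 1)"
    by metis
  have t0: "t \<longlonglongrightarrow> 0"
    using LIMSEQ_Suc[OF lim_const_over_n[of "e / 3"]] by (simp add: t_def[abs_def])
  have lim0: "c \<longlonglongrightarrow> 0" if "\<And>n. \<bar>c n\<bar> \<le> t n" for c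
    by (rule Lim_null_comparison[OF _ t0]) (use that in auto)
  have line: "(\<lambda>n. w (x + c n *\<^sub>R axis i 1 + c' n *\<^sub>R axis j 1)) \<longlonglongrightarrow> w x"
    if "smooth_fun_on (ball x e) w" "c \<longlonglongrightarrow> 0" "c' \<longlonglongrightarrow> 0" for w c c'
  proof -
    have "isCont w x"
      using smooth_fun_onD[OF that(1), of x] e(1) by (simp add: differentiable_imp_continuous_within)
    moreover have "(\<lambda>n. x + c n *\<^sub>R axis i 1 + c' n *\<^sub>R axis j 1) \<longlonglongrightarrow> x + 0 *\<^sub>R axis i 1 + 0 *\<^sub>R axis j 1"
      by (intro tendsto_intros that)
    ultimately show ?thesis using isCont_tendsto_compose[of x w] by simp
  qed
  have sm: "smooth_fun_on (ball x e) u" "smooth_fun_on (ball x e) v"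
    unfolding u_def v_def by (intro smooth_fun_on_partial_deriv f)+
  have "(\<lambda>n. v (x + s n *\<^sub>R axis i 1 + r n *\<^sub>R axis j 1)) \<longlonglongrightarrow> v x"
    by (intro line sm lim0 b)
  \<comment> \<open>By \<open>eq\<close> the same sequence consists of values of \<open>u\<close> at
    points tending to \<open>x\<close>.\<close>
  moreover have "(\<lambda>n. v (x + s n *\<^sub>R axis i 1 + r n *\<^sub>R axis j 1)) \<longlonglongrightarrow> u x"
    unfolding eq by (intro line sm lim0 b)
  ultimately have "u x = v x" using LIMSEQ_unique by blast
  then show ?thesis by (simp add: u_def v_def)
qed

section \<open>The inverse metric and the Christoffel symbols of a Hessian metric\<close>

lemma matrix_inv_2:
  fixes A :: "real^2^2"
  assumes "invertible A"
  shows "matrix_inv A = vector [vector [A$2$2 / det A, - A$1$2 / det A],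
                                vector [- A$2$1 / det A, A$1$1 / det A]]"
proof -
  define B :: "real^2^2" where "B = vector [vector [A$2$2 / det A, - A$1$2 / det A],
                                vector [- A$2$1 / det A, A$1$1 / det A]]"
  have d: "det A \<noteq> 0" using assms by (simp add: invertible_det_nz)
  have B: "A ** B = mat 1" "B ** A = mat 1"
    using d unfolding B_def
    by (simp_all add: vec_eq_iff forall_2 matrix_matrix_mult_def sum_2 mat_def field_simps)
       (simp_all add: det_2 algebra_simps)
  \<comment> \<open>\<open>matrix_inv\<close> is a Hilbert choice: \<open>B\<close> shows that a
    two-sided inverse exists, and uniqueness then identifies the chosen one with
    \<open>B\<close>.\<close>
  have "A ** matrix_inv A = mat 1 \<and> matrix_inv A ** A = mat 1"
    unfolding matrix_inv_def by (rule someI[of _ B]) (use B in simp)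
  then have "matrix_inv A = B"
    using B by (metis matrix_mul_assoc matrix_mul_lid matrix_mul_rid)
  then show ?thesis by (simp add: B_def)
qed


text \<open>For a Hessian metric all three terms in the Christoffel symbol are the same third
  derivative of \<open>f\<close>, so two of them cancel and one remains.\<close>

lemma christoffel_hessian:
  fixes f :: "real^'n::finite \<Rightarrow> real"
  assumes "open S" "smooth_fun_on S f" "x \<in> S"
  shows "christoffel (hessian f) i j k x =
    (\<Sum>l\<in>UNIV. matrix_inv (hessian f x) $ i $ l *
       partial_deriv l (partial_deriv j (partial_deriv k f)) x) / 2"
proof -
  have outer: "partial_deriv m (partial_deriv l (partial_deriv n f)) x
      = partial_deriv l (partial_deriv m (partial_deriv n f)) x" for l m n
    by (rule partial_deriv_commute[OF assms(1) smooth_fun_on_partial_deriv[OF assms(2)] assms(3)])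
  \<comment> \<open>The inner swap happens under another derivative, so it needs symmetry on all of
    \<open>S\<close> and not only at \<open>x\<close>.\<close>
  have inner: "partial_deriv l (partial_deriv k (partial_deriv j f)) x
      = partial_deriv l (partial_deriv j (partial_deriv k f)) x" for l
    by (rule partial_deriv_cong_open[OF assms(1,3) partial_deriv_commute[OF assms(1,2)]])
  show ?thesis
    by (simp add: christoffel_def hessian_def outer[of k] outer[of j] inner)
qed

text \<open>The entries of \<open>(A\<inverse>)' = - A\<inverse> A' A\<inverse>\<close> for \<open>A = [[a, b], [b, c]]\<close>. The right-hand sides
  are polynomial in the entries of the inverse, which makes the curvature a polynomial as well.\<close>

lemma DERIV_inverse_entries_sym_2:
  fixes a b c :: "real \<Rightarrow> real"
  assumes "(a has_real_derivative a') (at t)" "(b has_real_derivative b') (at t)"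
    "(c has_real_derivative c') (at t)" "a t * c t - b t * b t \<noteq> 0"
  defines "d \<equiv> a t * c t - b t * b t"
  shows "((\<lambda>t. c t / (a t * c t - b t * b t)) has_real_derivative
      - ((c t / d)\<^sup>2 * a' + 2 * (c t / d) * (- b t / d) * b' + (- b t / d)\<^sup>2 * c')) (at t)"
   "((\<lambda>t. - b t / (a t * c t - b t * b t)) has_real_derivative
      - ((c t / d) * (- b t / d) * a' + ((c t / d) * (a t / d) + (- b t / d)\<^sup>2) * b'
          + (- b t / d) * (a t / d) * c')) (at t)"
   "((\<lambda>t. a t / (a t * c t - b t * b t)) has_real_derivative
      - ((- b t / d)\<^sup>2 * a' + 2 * (- b t / d) * (a t / d) * b' + (a t / d)\<^sup>2 * c')) (at t)"
proof -
  have d: "d \<noteq> 0" using assms by simp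
  note der = derivative_eq_intros assms(1-3) refl
  show "((\<lambda>t. c t / (a t * c t - b t * b t)) has_real_derivative
      - ((c t / d)\<^sup>2 * a' + 2 * (c t / d) * (- b t / d) * b' + (- b t / d)\<^sup>2 * c')) (at t)"
    by (rule der assms(4))+ (use d in \<open>simp add: d_def[symmetric] field_simps power2_eq_square\<close>,
       simp add: d_def algebra_simps)
  show "((\<lambda>t. - b t / (a t * c t - b t * b t)) has_real_derivative
      - ((c t / d) * (- b t / d) * a' + ((c t / d) * (a t / d) + (- b t / d)\<^sup>2) * b'
          + (- b t / d) * (a t / d) * c')) (at t)"
    by (rule der assms(4))+ (use d in \<open>simp add: d_def[symmetric] field_simps power2_eq_square\<close>,
       simp add: d_def algebra_simps)
  show "((\<lambda>t. a t / (a t * c t - b t * b t)) has_real_derivative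
      - ((- b t / d)\<^sup>2 * a' + 2 * (- b t / d) * (a t / d) * b' + (a t / d)\<^sup>2 * c')) (at t)"
    by (rule der assms(4))+ (use d in \<open>simp add: d_def[symmetric] field_simps power2_eq_square\<close>,
       simp add: d_def algebra_simps)
qed

section \<open>The Gaussian curvature of a two-dimensional Hessian metric as a determinant\<close>

text \<open>The curvature is first written as a polynomial in the entries \<open>u\<close>,
  \<open>v\<close>, \<open>w\<close> of the inverse metric and the derivatives of the metric. Only
  then are \<open>u\<close>, \<open>v\<close>, \<open>w\<close> replaced by quotients, which turns
  the polynomial into the determinant.\<close>

lemma curvature_hessian_2:
  fixes f :: "real^2 \<Rightarrow> real"
  assumes S: "open S" and f: "smooth_fun_on S f" and x: "x \<in> S"
    and inv: "\<forall>y\<in>S. invertible (hessian f y)"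
  defines "a \<equiv> partial_deriv 1 (partial_deriv 1 f)"
    and "b \<equiv> partial_deriv 1 (partial_deriv 2 f)"
    and "c \<equiv> partial_deriv 2 (partial_deriv 2 f)"
  shows "curvature (hessian f) x =
    - det (vector [vector [a x, b x, c x],
                   vector [partial_deriv 1 a x, partial_deriv 1 b x, partial_deriv 1 c x],
                   vector [partial_deriv 2 a x, partial_deriv 2 b x, partial_deriv 2 c x]] :: real^3^3)
      / (4 * (a x * c x - b x * b x)\<^sup>2)"
proof -
  note sm = smooth_fun_on_partial_deriv
  note com = partial_deriv_commute[OF S]
  \<comment> \<open>By symmetry these four are all the third derivatives of \<open>f\<close>,
    ordered by the number of differentiations in direction 2.\<close>
  define A B C D where "A = partial_deriv 1 a" and "B = partial_deriv 1 b"
    and "C = partial_deriv 1 c" and "D = partial_deriv 2 c"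
  define d where "d y = a y * c y - b y * b y" for y
  define u v w where "u y = c y / d y" and "v y = - b y / d y" and "w y = a y / d y" for y
  have sab: "smooth_fun_on S a" "smooth_fun_on S b" "smooth_fun_on S c"
    "smooth_fun_on S A" "smooth_fun_on S B" "smooth_fun_on S C" "smooth_fun_on S D"
    unfolding a_def b_def c_def A_def B_def C_def D_def by (intro sm f)+
  \<comment> \<open>The symmetries are stated throughout \<open>S\<close> because they are
    differentiated again later.\<close>
  have b2: "partial_deriv 2 (partial_deriv 1 f) y = b y" if "y \<in> S" for y
    unfolding b_def by (rule com[OF f that])
  have pd_b2: "partial_deriv k (partial_deriv 2 (partial_deriv 1 f)) y = partial_deriv k b y"
    if "y \<in> S" for k y
    by (rule partial_deriv_cong_open[OF S that b2])
  have a2: "partial_deriv 2 a y = B y" if "y \<in> S" for y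
    using com[OF sm[OF f] that, of 2 1 1] pd_b2[OF that] unfolding a_def B_def by simp
  have b2': "partial_deriv 2 b y = C y" if "y \<in> S" for y
    using com[OF sm[OF f] that, of 2 1 2] unfolding b_def C_def c_def by simp
  have h: "hessian f y $ 1 $ 1 = a y" "hessian f y $ 1 $ 2 = b y"
    "hessian f y $ 2 $ 1 = b y" "hessian f y $ 2 $ 2 = c y" if "y \<in> S" for y
    using b2[OF that] by (simp_all add: hessian_def a_def b_def c_def)
  have det: "det (hessian f y) = d y" if "y \<in> S" for y
    by (simp add: det_2 h[OF that] d_def)
  have d0: "d y \<noteq> 0" if "y \<in> S" for y
    using inv that det[OF that] by (metis invertible_det_nz)
  have mi: "matrix_inv (hessian f y) $ 1 $ 1 = u y" "matrix_inv (hessian f y) $ 1 $ 2 = v y"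
    "matrix_inv (hessian f y) $ 2 $ 1 = v y" "matrix_inv (hessian f y) $ 2 $ 2 = w y"
    if "y \<in> S" for y
    using that by (simp_all add: matrix_inv_2[OF inv[rule_format, OF that]] det h u_def v_def w_def)
  have chr: "christoffel (hessian f) i 1 1 y
        = (matrix_inv (hessian f y) $ i $ 1 * A y + matrix_inv (hessian f y) $ i $ 2 * B y) / 2"
    "christoffel (hessian f) i 1 2 y
        = (matrix_inv (hessian f y) $ i $ 1 * B y + matrix_inv (hessian f y) $ i $ 2 * C y) / 2"
    "christoffel (hessian f) i 2 1 y
        = (matrix_inv (hessian f y) $ i $ 1 * B y + matrix_inv (hessian f y) $ i $ 2 * C y) / 2"
    "christoffel (hessian f) i 2 2 y
        = (matrix_inv (hessian f y) $ i $ 1 * C y + matrix_inv (hessian f y) $ i $ 2 * D y) / 2"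
    if "y \<in> S" for i y
    using a2[OF that] b2'[OF that] pd_b2[OF that]
    by (simp_all add: christoffel_hessian[OF S f that] sum_2 a_def b_def c_def A_def B_def C_def D_def)
  \<comment> \<open>The product rule for the shape shared by all the Christoffel symbols in
    \<open>chr\<close>.\<close>
  have pd_chr: "partial_deriv k (christoffel (hessian f) i j l) x = E"
    if "\<And>y. y \<in> S \<Longrightarrow> christoffel (hessian f) i j l y = (p y * P y + q y * Q y) / 2"
      "((\<lambda>t. p (x + t *\<^sub>R axis k 1)) has_real_derivative p') (at 0)"
      "((\<lambda>t. q (x + t *\<^sub>R axis k 1)) has_real_derivative q') (at 0)"
      "smooth_fun_on S P" "smooth_fun_on S Q"
      "E = (p' * P x + p x * partial_deriv k P x + q' * Q x + q x * partial_deriv k Q x) / 2"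
    for i j k l p q P Q p' q' E
  proof -
    have "((\<lambda>t. (p (x + t *\<^sub>R axis k 1) * P (x + t *\<^sub>R axis k 1)
          + q (x + t *\<^sub>R axis k 1) * Q (x + t *\<^sub>R axis k 1)) / 2) has_real_derivative E) (at 0)"
      using that(2,3) has_partial_deriv[OF smooth_fun_onD[OF that(4) x]]
        has_partial_deriv[OF smooth_fun_onD[OF that(5) x]]
      by (auto intro!: derivative_eq_intros simp: that(6))
    then have "partial_deriv k (\<lambda>y. (p y * P y + q y * Q y) / 2) x = E"
      unfolding partial_deriv_def[of k "\<lambda>y. (p y * P y + q y * Q y) / 2"] by (rule DERIV_imp_deriv)
    then show ?thesis using partial_deriv_cong_open[OF S x that(1)] by simp
  qed
  \<comment> \<open>The derivatives of \<open>u\<close>, \<open>v\<close>, \<open>w\<close> at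
    \<open>x\<close> in direction \<open>k\<close>, in the polynomial form obtained from the
    derivative of a matrix inverse.\<close>
  define U V W where
    "U k = - ((u x)\<^sup>2 * partial_deriv k a x + 2 * u x * v x * partial_deriv k b x
        + (v x)\<^sup>2 * partial_deriv k c x)" and
    "V k = - (u x * v x * partial_deriv k a x + (u x * w x + (v x)\<^sup>2) * partial_deriv k b x
        + v x * w x * partial_deriv k c x)" and
    "W k = - ((v x)\<^sup>2 * partial_deriv k a x + 2 * v x * w x * partial_deriv k b x
        + (w x)\<^sup>2 * partial_deriv k c x)" for k
  have duvw: "((\<lambda>t. u (x + t *\<^sub>R axis k 1)) has_real_derivative U k) (at 0)"
    "((\<lambda>t. v (x + t *\<^sub>R axis k 1)) has_real_derivative V k) (at 0)"
    "((\<lambda>t. w (x + t *\<^sub>R axis k 1)) has_real_derivative W k) (at 0)" for k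
    using DERIV_inverse_entries_sym_2[OF has_partial_deriv[OF smooth_fun_onD[OF sab(1) x]]
       has_partial_deriv[OF smooth_fun_onD[OF sab(2) x]]
       has_partial_deriv[OF smooth_fun_onD[OF sab(3) x]], of k k k] d0[OF x]
    unfolding U_def V_def W_def u_def v_def w_def d_def by simp_all
  \<comment> \<open>Upper index 1 contracts with the row \<open>u\<close>, \<open>v\<close> of the
    inverse, upper index 2 with the row \<open>v\<close>, \<open>w\<close>.\<close>
  note pc = pd_chr[OF _ duvw(1,2) _ _ refl] pd_chr[OF _ duvw(2,3) _ _ refl]
  have dchr: "partial_deriv k (christoffel (hessian f) 1 1 1) x
      = (U k * A x + u x * partial_deriv k A x + V k * B x + v x * partial_deriv k B x) / 2"
    "partial_deriv k (christoffel (hessian f) 1 1 2) x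
      = (U k * B x + u x * partial_deriv k B x + V k * C x + v x * partial_deriv k C x) / 2"
    "partial_deriv k (christoffel (hessian f) 1 2 1) x
      = (U k * B x + u x * partial_deriv k B x + V k * C x + v x * partial_deriv k C x) / 2"
    "partial_deriv k (christoffel (hessian f) 1 2 2) x
      = (U k * C x + u x * partial_deriv k C x + V k * D x + v x * partial_deriv k D x) / 2"
    "partial_deriv k (christoffel (hessian f) 2 1 1) x
      = (V k * A x + v x * partial_deriv k A x + W k * B x + w x * partial_deriv k B x) / 2"
    "partial_deriv k (christoffel (hessian f) 2 1 2) x
      = (V k * B x + v x * partial_deriv k B x + W k * C x + w x * partial_deriv k C x) / 2"
    "partial_deriv k (christoffel (hessian f) 2 2 1) x
      = (V k * B x + v x * partial_deriv k B x + W k * C x + w x * partial_deriv k C x) / 2"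
    "partial_deriv k (christoffel (hessian f) 2 2 2) x
      = (V k * C x + v x * partial_deriv k C x + W k * D x + w x * partial_deriv k D x) / 2" for k
    by (rule pc; simp add: chr mi sab)+
  \<comment> \<open>With these identifications the fourth derivatives cancel in the
    curvature.\<close>
  have p4: "partial_deriv 2 A x = partial_deriv 1 B x" "partial_deriv 2 B x = partial_deriv 1 C x"
     "partial_deriv 2 C x = partial_deriv 1 D x"
  proof -
    have "partial_deriv 2 A x = partial_deriv 1 (partial_deriv 2 a) x"
      unfolding A_def by (rule com[OF sab(1) x])
    then show "partial_deriv 2 A x = partial_deriv 1 B x"
      using partial_deriv_cong_open[OF S x a2] by simp
    have "partial_deriv 2 B x = partial_deriv 1 (partial_deriv 2 b) x"
      unfolding B_def by (rule com[OF sab(2) x])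
    then show "partial_deriv 2 B x = partial_deriv 1 C x"
      using partial_deriv_cong_open[OF S x b2'] by simp
    show "partial_deriv 2 C x = partial_deriv 1 D x"
      unfolding C_def D_def by (rule com[OF sab(3) x])
  qed
  have p3: "partial_deriv 1 a x = A x" "partial_deriv 1 b x = B x" "partial_deriv 1 c x = C x"
     "partial_deriv 2 a x = B x" "partial_deriv 2 b x = C x" "partial_deriv 2 c x = D x"
    using a2[OF x] b2'[OF x] by (simp_all add: A_def B_def C_def D_def)
  \<comment> \<open>A polynomial identity, with the values of \<open>u\<close>, \<open>v\<close>,
    \<open>w\<close> and of the third derivatives treated as independent variables.\<close>
  have "curvature (hessian f) x = - (u x * w x - (v x)\<^sup>2) *
     (w x * (B x * D x - (C x)\<^sup>2) + v x * (A x * D x - B x * C x) + u x * (A x * C x - (B x)\<^sup>2)) / 4"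
    unfolding curvature_def scalar_curvature_def sum_2 mi[OF x] dchr p4 chr[OF x] U_def V_def W_def p3
    by (simp add: field_simps power2_eq_square)
  \<comment> \<open>The determinant of the inverse metric is the reciprocal of that of the
    metric.\<close>
  also have "u x * w x - (v x)\<^sup>2 = 1 / d x"
    using d0[OF x] unfolding u_def v_def w_def
    by (simp add: field_simps power2_eq_square) (simp add: d_def algebra_simps)
  \<comment> \<open>A second factor \<open>1 / d x\<close> comes out of \<open>u\<close>,
    \<open>v\<close>, \<open>w\<close>. What is left is the cofactor expansion of the determinant
    along its first row.\<close>
  also have "- (1 / d x) *
     (w x * (B x * D x - (C x)\<^sup>2) + v x * (A x * D x - B x * C x) + u x * (A x * C x - (B x)\<^sup>2)) / 4
    = - (a x * (B x * D x - (C x)\<^sup>2) - b x * (A x * D x - B x * C x) + c x * (A x * C x - (B x)\<^sup>2))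
      / (4 * (d x)\<^sup>2)"
    using d0[OF x] unfolding u_def v_def w_def by (simp add: field_simps power2_eq_square)
  finally show ?thesis
    unfolding p3 by (simp add: det_3 d_def power2_eq_square algebra_simps)
qed


section \<open>The two flatness criteria\<close>

text \<open>Since \<open>p\<close>, \<open>q\<close>, \<open>r\<close> are constants, the relation
  may be differentiated in both directions. It then holds in each row of the determinant's matrix,
  so \<open>vector [p, q, r]\<close> is a nonzero kernel vector.\<close>

lemma flat_on_hessian_2_if_linear_relation:
  fixes f :: "real^2 \<Rightarrow> real"
  assumes S: "open S" and f: "smooth_fun_on S f" and inv: "\<forall>y\<in>S. invertible (hessian f y)"
    and rel: "\<forall>y\<in>S. p * hessian f y $ 1 $ 1 + q * hessian f y $ 1 $ 2 + r * hessian f y $ 2 $ 2 = 0"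
    and nz: "p \<noteq> 0 \<or> q \<noteq> 0 \<or> r \<noteq> 0"
  shows "flat_on S (hessian f)"
  unfolding flat_on_def
proof
  fix x assume x: "x \<in> S"
  define a b c where "a = partial_deriv 1 (partial_deriv 1 f)"
    and "b = partial_deriv 1 (partial_deriv 2 f)"
    and "c = partial_deriv 2 (partial_deriv 2 f)"
  have sm: "smooth_fun_on S a" "smooth_fun_on S b" "smooth_fun_on S c"
    unfolding a_def b_def c_def by (intro smooth_fun_on_partial_deriv f)+
  have rel': "p * a y + q * b y + r * c y = 0" if "y \<in> S" for y
    using rel that by (simp add: hessian_def a_def b_def c_def)
  have drel: "p * partial_deriv k a x + q * partial_deriv k b x + r * partial_deriv k c x = 0" for k
  proof -
    have "((\<lambda>t. p * a (x + t *\<^sub>R axis k 1) + q * b (x + t *\<^sub>R axis k 1)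
        + r * c (x + t *\<^sub>R axis k 1)) has_real_derivative
        p * partial_deriv k a x + q * partial_deriv k b x + r * partial_deriv k c x) (at 0)"
      by (intro DERIV_add DERIV_cmult has_partial_deriv smooth_fun_onD[OF _ x] sm)
    then have "partial_deriv k (\<lambda>y. p * a y + q * b y + r * c y) x
        = p * partial_deriv k a x + q * partial_deriv k b x + r * partial_deriv k c x"
      unfolding partial_deriv_def[of k "\<lambda>y. p * a y + q * b y + r * c y"] by (rule DERIV_imp_deriv)
    moreover have "partial_deriv k (\<lambda>y. p * a y + q * b y + r * c y) x
        = partial_deriv k (\<lambda>y. 0) x"
      by (rule partial_deriv_cong_open[OF S x rel'])
    ultimately show ?thesis by (simp add: partial_deriv_def)
  qed
  let ?M = "vector [vector [a x, b x, c x],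
                   vector [partial_deriv 1 a x, partial_deriv 1 b x, partial_deriv 1 c x],
                   vector [partial_deriv 2 a x, partial_deriv 2 b x, partial_deriv 2 c x]] :: real^3^3"
  have "?M *v vector [p, q, r] = 0"
    using rel'[OF x] drel[of 1] drel[of 2]
    by (simp add: vec_eq_iff forall_3 matrix_vector_mult_def sum_3 mult.commute)
  moreover have "vector [p, q, r] \<noteq> (0 :: real^3)"
    using nz by (auto simp: vec_eq_iff forall_3)
  ultimately have "\<not> invertible ?M"
    unfolding invertible_left_inverse matrix_left_invertible_ker by blast
  then have "det ?M = 0" using invertible_det_nz by blast
  then show "curvature (hessian f) x = 0"
    using curvature_hessian_2[OF S f x inv] by (simp add: a_def b_def c_def)
qed

text \<open>Moving in direction \<open>k\<close> leaves coordinate \<open>q\<close> fixed, so a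
  constant is differentiated, however irregular \<phi> may be.\<close>

lemma partial_deriv_eq_0:
  assumes "open S" "x \<in> S" "\<forall>y\<in>S. f y = \<phi> (y $ q)" "k \<noteq> q"
  shows "partial_deriv k f x = 0"
proof -
  have "partial_deriv k f x = partial_deriv k (\<lambda>y. \<phi> (y $ q)) x"
    using assms by (intro partial_deriv_cong_open[of S]) auto
  also have "\<dots> = 0" using assms(4) by (simp add: partial_deriv_def axis_def)
  finally show ?thesis .
qed

lemma flat_on_hessian_2_if_one_variable:
  fixes f :: "real^2 \<Rightarrow> real"
  assumes S: "open S" and f: "smooth_fun_on S f" and inv: "\<forall>y\<in>S. invertible (hessian f y)"
    and one: "\<forall>i j. \<exists>\<phi> :: real \<Rightarrow> real. \<forall>y\<in>S. hessian f y $ i $ j = \<phi> (y $ q)"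
  shows "flat_on S (hessian f)"
  unfolding flat_on_def
proof
  fix x assume x: "x \<in> S"
  have z: "partial_deriv k (partial_deriv i (partial_deriv j f)) x = 0" if "k \<noteq> q" for i j k
  proof -
    obtain \<phi> where "\<forall>y\<in>S. hessian f y $ i $ j = \<phi> (y $ q)" using one by blast
    then have "\<forall>y\<in>S. partial_deriv i (partial_deriv j f) y = \<phi> (y $ q)"
      by (simp add: hessian_def)
    then show ?thesis using partial_deriv_eq_0[OF S x] that by blast
  qed
  \<comment> \<open>For \<open>q = 1\<close> the row of derivatives in direction 2 vanishes, for
    \<open>q = 2\<close> that in direction 1.\<close>
  have "q = 1 \<or> q = 2" by (rule exhaust_2)
  then show "curvature (hessian f) x = 0"
    by (auto simp: curvature_hessian_2[OF S f x inv] det_3 z)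
qed

section \<open>Reduction of all the listed forms to the two criteria\<close>

theorem theorem3p3:
  fixes \<Theta> :: "(real^2) set"
    and h :: "real^'m::finite \<Rightarrow> real^2"
    and k :: "real^'m \<Rightarrow> real"
    and \<psi> :: "real^2 \<Rightarrow> real"
    and g :: "real^2 \<Rightarrow> real^2^2"
  defines "g \<equiv> hessian \<psi>"
  assumes "open \<Theta>"
    and "exponential_family \<Theta> h k \<psi>"
    and "smooth_fun_on \<Theta> \<psi>"
    and "\<forall>\<theta>\<in>\<Theta>. invertible (g \<theta>)"
  shows
    "((\<exists>i j. \<forall>\<theta>\<in>\<Theta>. g \<theta> $ i $ j = 0) \<longrightarrow> flat_on \<Theta> g) \<and>
     (\<forall>a b c :: real^2 \<Rightarrow> real.
        (\<forall>\<theta>\<in>\<Theta>. g \<theta> = sym_mat2 0 (b \<theta>) (c \<theta>)) \<or>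
        (\<forall>\<theta>\<in>\<Theta>. g \<theta> = sym_mat2 (a \<theta>) (b \<theta>) 0) \<or>
        (\<forall>\<theta>\<in>\<Theta>. g \<theta> = sym_mat2 (a \<theta>) 0 (c \<theta>)) \<longrightarrow> flat_on \<Theta> g)
     \<and>
     ((\<exists>i j i' j'. {i, j} \<noteq> {i', j'} \<and> (\<exists>r::real. \<forall>\<theta>\<in>\<Theta>. g \<theta> $ i $ j = r * g \<theta> $ i' $ j'))
        \<longrightarrow> flat_on \<Theta> g) \<and>
     (\<forall>(r::real) (a :: real^2 \<Rightarrow> real) (b :: real^2 \<Rightarrow> real) (c :: real^2 \<Rightarrow> real).
        (\<forall>\<theta>\<in>\<Theta>. g \<theta> = sym_mat2 (a \<theta>) (r * c \<theta>) (c \<theta>)) \<or>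
        (\<forall>\<theta>\<in>\<Theta>. g \<theta> = sym_mat2 (a \<theta>) (r * a \<theta>) (c \<theta>)) \<or>
        (\<forall>\<theta>\<in>\<Theta>. g \<theta> = sym_mat2 (r * b \<theta>) (b \<theta>) (c \<theta>)) \<or>
        (\<forall>\<theta>\<in>\<Theta>. g \<theta> = sym_mat2 (a \<theta>) (b \<theta>) (r * b \<theta>)) \<or>
        (\<forall>\<theta>\<in>\<Theta>. g \<theta> = sym_mat2 (r * c \<theta>) (b \<theta>) (c \<theta>)) \<longrightarrow> flat_on \<Theta> g)
     \<and>
     ((\<exists>q. \<forall>i j. \<exists>f :: real \<Rightarrow> real. \<forall>\<theta>\<in>\<Theta>. g \<theta> $ i $ j = f (\<theta> $ q)) \<longrightarrow> flat_on \<Theta> g) \<and>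
     (\<forall>a b c :: real \<Rightarrow> real.
        (\<forall>\<theta>\<in>\<Theta>. g \<theta> = sym_mat2 (a (\<theta> $ 1)) (b (\<theta> $ 1)) (c (\<theta> $ 1))) \<or>
        (\<forall>\<theta>\<in>\<Theta>. g \<theta> = sym_mat2 (a (\<theta> $ 2)) (b (\<theta> $ 2)) (c (\<theta> $ 2))) \<longrightarrow> flat_on \<Theta> g)"
proof -
  let ?flat = "flat_on \<Theta> g"
  note ass = assms(2,4) assms(5)[unfolded assms(1)]
  have lin: ?flat if "\<forall>\<theta>\<in>\<Theta>. p * g \<theta> $ 1 $ 1 + q * g \<theta> $ 1 $ 2 + r * g \<theta> $ 2 $ 2 = 0"
    "p \<noteq> 0 \<or> q \<noteq> 0 \<or> r \<noteq> 0" for p q r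
    using flat_on_hessian_2_if_linear_relation[OF ass] that unfolding g_def by blast
  have one: ?flat if "\<forall>i j. \<exists>f :: real \<Rightarrow> real. \<forall>\<theta>\<in>\<Theta>. g \<theta> $ i $ j = f (\<theta> $ q)" for q
    using flat_on_hessian_2_if_one_variable[OF ass] that unfolding g_def by blast
  have sym: "g \<theta> $ 2 $ 1 = g \<theta> $ 1 $ 2" if "\<theta> \<in> \<Theta>" for \<theta>
    using partial_deriv_commute[OF assms(2,4) that] by (simp add: g_def hessian_def)
  have two: "i = 1 \<or> i = 2" for i :: 2 by (rule exhaust_2)
  \<comment> \<open>Comparing index sets identifies \<open>g12\<close> with \<open>g21\<close>. Six
    ordered pairs of distinct components remain, one for each instance of \<open>lin\<close>:
    coefficient 1 at the left component and \<open>-r\<close> at the right one.\<close>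
  have dep: ?flat if ne: "{i, j} \<noteq> {i', j'}" and r: "\<forall>\<theta>\<in>\<Theta>. g \<theta> $ i $ j = r * g \<theta> $ i' $ j'"
    for i j i' j' r
    using two[of i] two[of j] two[of i'] two[of j'] ne r
    using lin[of 1 "-r" 0] lin[of 1 0 "-r"] lin[of "-r" 1 0] lin[of 0 1 "-r"]
      lin[of "-r" 0 1] lin[of 0 "-r" 1]
    by (elim disjE) (simp_all add: sym insert_commute)
  \<comment> \<open>A vanishing entry is a linear relation with a single nonzero
    coefficient.\<close>
  have zero: ?flat if z: "\<forall>\<theta>\<in>\<Theta>. g \<theta> $ i $ j = 0" for i j
    using two[of i] two[of j] z lin[of 1 0 0] lin[of 0 1 0] lin[of 0 0 1]
    by (elim disjE) (simp_all add: sym)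
  have mat: "sym_mat2 a b c $ 1 $ 1 = a" "sym_mat2 a b c $ 1 $ 2 = b"
    "sym_mat2 a b c $ 2 $ 1 = b" "sym_mat2 a b c $ 2 $ 2 = c" for a b c
    by (simp_all add: sym_mat2_def)
  have one': ?flat if "\<forall>\<theta>\<in>\<Theta>. g \<theta> = sym_mat2 (a (\<theta> $ q)) (b (\<theta> $ q)) (c (\<theta> $ q))"
    for a b c and q :: 2
    using one[of q] that by (simp add: forall_2 mat) blast
  show ?thesis
  proof (intro conjI allI impI; (elim exE conjE)?)
    show ?flat if "\<forall>\<theta>\<in>\<Theta>. g \<theta> $ i $ j = 0" for i j using that by (rule zero)
    show ?flat if "{i, j} \<noteq> {i', j'}" "\<forall>\<theta>\<in>\<Theta>. g \<theta> $ i $ j = r * g \<theta> $ i' $ j'" for i j i' j' r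
      using that by (rule dep)
    show ?flat if "\<forall>i j. \<exists>f :: real \<Rightarrow> real. \<forall>\<theta>\<in>\<Theta>. g \<theta> $ i $ j = f (\<theta> $ q)" for q
      using that by (rule one)
    show ?flat if "(\<forall>\<theta>\<in>\<Theta>. g \<theta> = sym_mat2 0 (b \<theta>) (c \<theta>)) \<or>
          (\<forall>\<theta>\<in>\<Theta>. g \<theta> = sym_mat2 (a \<theta>) (b \<theta>) 0) \<or>
          (\<forall>\<theta>\<in>\<Theta>. g \<theta> = sym_mat2 (a \<theta>) 0 (c \<theta>))" for a b c
      using that zero[of 1 1] zero[of 1 2] zero[of 2 2] by (elim disjE) (simp_all add: mat)
    show ?flat if "(\<forall>\<theta>\<in>\<Theta>. g \<theta> = sym_mat2 (a \<theta>) (r * c \<theta>) (c \<theta>)) \<or>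
          (\<forall>\<theta>\<in>\<Theta>. g \<theta> = sym_mat2 (a \<theta>) (r * a \<theta>) (c \<theta>)) \<or>
          (\<forall>\<theta>\<in>\<Theta>. g \<theta> = sym_mat2 (r * b \<theta>) (b \<theta>) (c \<theta>)) \<or>
          (\<forall>\<theta>\<in>\<Theta>. g \<theta> = sym_mat2 (a \<theta>) (b \<theta>) (r * b \<theta>)) \<or>
          (\<forall>\<theta>\<in>\<Theta>. g \<theta> = sym_mat2 (r * c \<theta>) (b \<theta>) (c \<theta>))" for r a b c
      using that lin[of 0 1 "-r"] lin[of "-r" 1 0] lin[of 1 "-r" 0] lin[of 0 "-r" 1] lin[of 1 0 "-r"]
      by (elim disjE) (simp_all add: mat)
    show ?flat if "(\<forall>\<theta>\<in>\<Theta>. g \<theta> = sym_mat2 (a (\<theta> $ 1)) (b (\<theta> $ 1)) (c (\<theta> $ 1))) \<or>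
        (\<forall>\<theta>\<in>\<Theta>. g \<theta> = sym_mat2 (a (\<theta> $ 2)) (b (\<theta> $ 2)) (c (\<theta> $ 2)))" for a b c
      using that one'[of a 1 b c] one'[of a 2 b c] by argo
  qed
qed

end
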